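(* Let $G=(V,E)$ be a connected graph on $n$ nodes and let $0<\alpha<1$. (i) If $\alpha>\frac34$, then $2\alpha\sqrt{n}-1\le \overleftarrow{MD}_{\alpha}(G)\le n$. (ii) If $\alpha\le \frac34$, then $1\le \overleftarrow{MD}_{\alpha}(G)\le n$.
   Context: A configuration is a map $\mathcal{C}:V\to\{b,w\}$ (black/white). In two-way $\alpha$-bootstrap percolation ($0<\alpha<1$), starting from $\mathcal{C}_0$, in each round $t\ge1$ all nodes update simultaneously: $\mathcal{C}_t(v)=b$ if the number of neighbors of $v$ that are black in $\mathcal{C}_{t-1}$ is at least $\alpha d(v)$ ($d(v)$ the degree of $v$), and $\mathcal{C}_t(v)=w$ otherwise. A set $D\subseteq V$ is a dynamo if for every initial configuration in which all nodes of $D$ are black, there is a round at which all nodes of $V$ are black. $\overleftarrow{MD}_\alpha(G)$ denotes the minimum size of a dynamo in two-way $\alpha$-bootstrap percolation on $G$.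
   Formalization: The graph is assumed to have n ≥ 2 nodes: for n = 1 the single node has degree 0 and becomes black in round 1 from any start, so the empty set is a dynamo, the minimum size is 0, and both lower bounds fail. *)

theory Defs
  imports Complex_Main "Graph_Theory.Graph_Theory"
begin

text \<open>Finite simple undirected graphs are the symmetric, loop-free digraphs without parallel arcs
  of the locale \<^locale>\<open>graph\<close>. The arcs then come in pairs, one for each direction of an edge,
  so \<^const>\<open>out_degree\<close> is the degree in the undirected sense.\<close>

datatype colour = Black | White

definition black_neighbours :: "('a, 'b) pre_digraph \<Rightarrow> ('a \<Rightarrow> colour) \<Rightarrow> 'a \<Rightarrow> 'a set" where
  "black_neighbours G C v = {u \<in> verts G. v \<rightarrow>\<^bsub>G\<^esub> u \<and> C u = Black}"

text \<open>Configurations are total functions on the vertex type; colours outside \<^term>\<open>verts G\<close>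
  have no influence on the process.\<close>

definition two_way_step ::
    "('a, 'b) pre_digraph \<Rightarrow> real \<Rightarrow> ('a \<Rightarrow> colour) \<Rightarrow> 'a \<Rightarrow> colour" where
  "two_way_step G \<alpha> C v =
     (if real (card (black_neighbours G C v)) \<ge> \<alpha> * real (out_degree G v) then Black else White)"

definition config_at ::
    "('a, 'b) pre_digraph \<Rightarrow> real \<Rightarrow> ('a \<Rightarrow> colour) \<Rightarrow> nat \<Rightarrow> 'a \<Rightarrow> colour" where
  "config_at G \<alpha> C\<^sub>0 t = (two_way_step G \<alpha> ^^ t) C\<^sub>0"

definition two_way_dynamo :: "('a, 'b) pre_digraph \<Rightarrow> real \<Rightarrow> 'a set \<Rightarrow> bool" where
  "two_way_dynamo G \<alpha> D \<longleftrightarrow>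
     D \<subseteq> verts G \<and>
     (\<forall>C\<^sub>0. (\<forall>v\<in>D. C\<^sub>0 v = Black) \<longrightarrow> (\<exists>t. \<forall>v\<in>verts G. config_at G \<alpha> C\<^sub>0 t v = Black))"

definition min_two_way_dynamo :: "('a, 'b) pre_digraph \<Rightarrow> real \<Rightarrow> nat" where
  "min_two_way_dynamo G \<alpha> = Min {card D | D. two_way_dynamo G \<alpha> D}"

lemma two_way_dynamo_verts: "two_way_dynamo G \<alpha> (verts G)"
  unfolding two_way_dynamo_def config_at_def by (auto intro: exI[of _ 0])

lemma finite_dynamo_sizes:
  assumes "graph G"
  shows "finite {card D | D. two_way_dynamo G \<alpha> D}"
proof -
  interpret graph G by fact
  have "{card D | D. two_way_dynamo G \<alpha> D} \<subseteq> card ` Pow (verts G)"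
    by (auto simp: two_way_dynamo_def)
  then show ?thesis by (rule finite_subset) simp
qed

text \<open>On a single vertex the threshold is \<open>\<alpha> \<cdot> 0 = 0\<close>, so the vertex is black from the first
  round on whatever its initial colour. Lower bounds on the minimum size of a dynamo by a
  positive number therefore need at least two vertices.\<close>

lemma min_two_way_dynamo_single_vertex:
  fixes G :: "('a, 'b) pre_digraph"
  assumes "graph G" and "card (verts G) = 1"
  shows "min_two_way_dynamo G \<alpha> = 0"
proof -
  interpret graph G by fact
  obtain v where v: "verts G = {v}" using assms(2) by (auto simp: card_1_singleton_iff)
  have "out_arcs G v = {}"
  proof -
    have False if "e \<in> arcs G" for e
      using no_loops[OF that] tail_in_verts[OF that] head_in_verts[OF that] by (simp add: v)
    then show ?thesis unfolding out_arcs_def by blast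
  qed
  then have "out_degree G v = 0" by (simp add: out_degree_def)
  then have "config_at G \<alpha> C 1 v = Black" for C
    by (simp add: config_at_def two_way_step_def)
  then have "two_way_dynamo G \<alpha> {}"
    unfolding two_way_dynamo_def v by blast
  then have "card ({} :: 'a set) \<in> {card D | D. two_way_dynamo G \<alpha> D}" by blast
  from Min_le[OF finite_dynamo_sizes[OF assms(1)] this] show ?thesis
    by (simp add: min_two_way_dynamo_def)
qed

end

theory Submission
  imports Defs
begin

text \<open>With the integer thresholds \<open>\<tau> v = \<lceil>\<alpha> d(v)\<rceil>\<close>, consider the Goles--Olivos energy
  \<open>E(X, Y) = \<tau>(X) + \<tau>(Y) - e(X, Y)\<close> of two vertex sets, where \<open>e\<close> counts adjacent ordered pairs.
  If \<open>B\<^sub>t\<close> is the black set at time \<open>t\<close>, then \<open>Y = B\<^sub>t\<^sub>+\<^sub>1\<close> minimises \<open>E(B\<^sub>t, Y)\<close>, so by symmetry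
  \<open>E(B\<^sub>t, B\<^sub>t\<^sub>+\<^sub>1)\<close> is nonincreasing. If the black set \<open>D\<close> eventually takes over the whole vertex set \<open>V\<close>,
  this gives \<open>E(V, V) \<le> E(D, Y)\<close> for every \<open>Y\<close>. Let \<open>W = V - D\<close>, \<open>k = |D|\<close> and
  \<open>\<beta> = (1 - \<alpha>) / \<alpha>\<close>. The choices \<open>Y = {}\<close> and \<open>Y = W\<close> give
  \<open>\<Sum>\<^sub>W (2 \<tau> - d) \<le> \<Sum>\<^sub>D (d - \<tau>)\<close> and \<open>\<Sum>\<^sub>D \<tau> \<le> k (k - 1) + \<Sum>\<^sub>W (d - \<tau>)\<close>. Since \<open>d - \<tau> \<le> \<beta> \<tau>\<close>, it
  follows that \<open>\<Sum>\<^sub>W (2 \<tau> - d - \<beta> (d - \<tau>)) \<le> \<beta> k (k - 1)\<close>, and for \<open>\<alpha> > 3/4\<close> integrality of \<open>\<tau>\<close>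
  makes each summand at least 1. Hence \<open>n \<le> k + \<beta> k (k - 1)\<close>, from which
  \<open>4 \<alpha>\<^sup>2 n \<le> (k + 1)\<^sup>2\<close>.\<close>

section \<open>Adjacent pairs and the energy of two vertex sets\<close>

definition adjacent_in :: "('a, 'b) pre_digraph \<Rightarrow> 'a set \<Rightarrow> 'a \<Rightarrow> nat" where
  "adjacent_in G X v = card {u \<in> X. v \<rightarrow>\<^bsub>G\<^esub> u}"

definition threshold :: "('a, 'b) pre_digraph \<Rightarrow> real \<Rightarrow> 'a \<Rightarrow> int" where
  "threshold G \<alpha> v = \<lceil>\<alpha> * real (out_degree G v)\<rceil>"

definition energy :: "('a, 'b) pre_digraph \<Rightarrow> real \<Rightarrow> 'a set \<Rightarrow> 'a set \<Rightarrow> int" where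
  "energy G \<alpha> X Y =
     (\<Sum>v\<in>X. threshold G \<alpha> v) + (\<Sum>v\<in>Y. threshold G \<alpha> v) - (\<Sum>v\<in>Y. int (adjacent_in G X v))"

definition black_set :: "('a, 'b) pre_digraph \<Rightarrow> ('a \<Rightarrow> colour) \<Rightarrow> 'a set" where
  "black_set G C = {v \<in> verts G. C v = Black}"

lemma threshold_le_out_degree:
  assumes "\<alpha> \<le> 1"
  shows "threshold G \<alpha> v \<le> int (out_degree G v)"
  unfolding threshold_def ceiling_le_iff
  using mult_right_mono[OF assms, of "real (out_degree G v)"] by simp

context graph
begin

text \<open>Without parallel arcs, distinct out-arcs have distinct heads, so counting arcs counts
  neighbours.\<close>

lemma out_degree_eq_adjacent_in: "out_degree G v = adjacent_in G (verts G) v"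
proof -
  have "inj_on (head G) (out_arcs G v)"
    by (rule inj_onI) (auto intro: no_multi_arcs simp: arc_to_ends_def)
  moreover have "head G ` out_arcs G v = {u \<in> verts G. v \<rightarrow>\<^bsub>G\<^esub> u}"
    by (auto simp: arcs_ends_conv)
  ultimately show ?thesis
    unfolding adjacent_in_def out_degree_def using card_image by fastforce
qed

lemma sum_adjacent_in_commute:
  assumes "finite X" "finite Y"
  shows "(\<Sum>v\<in>Y. adjacent_in G X v) = (\<Sum>v\<in>X. adjacent_in G Y v)"
proof -
  have *: "adjacent_in G Z v = (\<Sum>u\<in>Z. of_bool (v \<rightarrow>\<^bsub>G\<^esub> u))" if "finite Z" for Z v
    using that by (simp add: adjacent_in_def Collect_conj_eq)
  have "(\<Sum>v\<in>Y. adjacent_in G X v) = (\<Sum>u\<in>X. \<Sum>v\<in>Y. of_bool (v \<rightarrow>\<^bsub>G\<^esub> u))"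
    unfolding *[OF assms(1)] by (rule sum.swap)
  also have "\<dots> = (\<Sum>u\<in>X. \<Sum>v\<in>Y. of_bool (u \<rightarrow>\<^bsub>G\<^esub> v))"
    by (intro sum.cong refl arg_cong[where f = of_bool]) (blast intro: graph_symmetric)
  finally show ?thesis by (simp add: *[OF assms(2)])
qed

lemma energy_commute:
  assumes "finite X" "finite Y"
  shows "energy G \<alpha> X Y = energy G \<alpha> Y X"
  using sum_adjacent_in_commute[OF assms]
  by (simp add: energy_def flip: of_nat_sum)

lemma adjacent_in_Un:
  assumes "finite X" "finite Y" "X \<inter> Y = {}"
  shows "adjacent_in G (X \<union> Y) v = adjacent_in G X v + adjacent_in G Y v"
proof -
  have "{u \<in> X \<union> Y. v \<rightarrow>\<^bsub>G\<^esub> u} = {u \<in> X. v \<rightarrow>\<^bsub>G\<^esub> u} \<union> {u \<in> Y. v \<rightarrow>\<^bsub>G\<^esub> u}" by blast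
  then show ?thesis
    using assms by (simp add: adjacent_in_def) (subst card_Un_disjoint; auto)
qed

lemma adjacent_in_le_card:
  assumes "finite X" "v \<in> X"
  shows "adjacent_in G X v \<le> card X - 1"
proof -
  have "{u \<in> X. v \<rightarrow>\<^bsub>G\<^esub> u} \<subseteq> X - {v}" using adj_not_same by auto
  then have "adjacent_in G X v \<le> card (X - {v})"
    unfolding adjacent_in_def using assms by (intro card_mono) auto
  then show ?thesis using assms by simp
qed

section \<open>Decrease of the energy along the process\<close>

lemma black_set_two_way_step:
  "black_set G (two_way_step G \<alpha> C) =
     {v \<in> verts G. threshold G \<alpha> v \<le> int (adjacent_in G (black_set G C) v)}"
proof -
  have "black_neighbours G C v = {u \<in> black_set G C. v \<rightarrow>\<^bsub>G\<^esub> u}" for v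
    by (auto simp: black_neighbours_def black_set_def)
  then show ?thesis
    by (auto simp: black_set_def two_way_step_def adjacent_in_def threshold_def ceiling_le_iff
        split: if_splits)
qed

text \<open>For fixed first argument, the energy is a constant plus a sum of \<open>f\<close> over
  the second. One step selects exactly the vertices with \<open>f v \<le> 0\<close>, which minimises
  that sum.\<close>

lemma energy_two_way_step_le:
  assumes "Y \<subseteq> verts G"
  shows "energy G \<alpha> (black_set G C) (black_set G (two_way_step G \<alpha> C))
           \<le> energy G \<alpha> (black_set G C) Y"
proof -
  define f where "f v = threshold G \<alpha> v - int (adjacent_in G (black_set G C) v)" for v
  have B: "black_set G (two_way_step G \<alpha> C) = {v \<in> verts G. f v \<le> 0}" (is "?B = _")
    by (auto simp: black_set_two_way_step f_def)
  have "sum f ?B = sum f (?B \<inter> Y) + sum f (?B - Y)"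
    by (rule sum.Int_Diff) (simp add: B)
  also have "sum f (?B - Y) \<le> 0" by (rule sum_nonpos) (auto simp: B)
  also have "sum f (?B \<inter> Y) \<le> sum f Y"
    using assms finite_subset[OF assms] by (intro sum_mono2) (auto simp: B not_le less_imp_le)
  finally show ?thesis by (simp add: energy_def f_def sum_subtractf)
qed

lemma finite_black_set [simp]: "finite (black_set G C)"
  by (simp add: black_set_def)

lemma config_at_Suc: "config_at G \<alpha> C (Suc t) = two_way_step G \<alpha> (config_at G \<alpha> C t)"
  by (simp add: config_at_def)

lemma energy_config_at_le:
  assumes "Y \<subseteq> verts G"
  shows "energy G \<alpha> (black_set G (config_at G \<alpha> C t)) (black_set G (config_at G \<alpha> C (Suc t)))
           \<le> energy G \<alpha> (black_set G C) Y"
proof (induction t)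
  case 0
  show ?case using energy_two_way_step_le[OF assms] by (simp add: config_at_def)
next
  case (Suc t)
  \<comment> \<open>The competitor for the minimum is the black set one round earlier; swapping the
    arguments then yields the energy of the previous round.\<close>
  have "energy G \<alpha> (black_set G (config_at G \<alpha> C (Suc t))) (black_set G (config_at G \<alpha> C (Suc (Suc t))))
      \<le> energy G \<alpha> (black_set G (config_at G \<alpha> C (Suc t))) (black_set G (config_at G \<alpha> C t))"
    unfolding config_at_Suc[of _ _ "Suc t"]
    by (rule energy_two_way_step_le) (auto simp: black_set_def)
  with Suc.IH show ?case by (simp add: energy_commute)
qed

lemma energy_dynamo_ge:
  assumes "two_way_dynamo G \<alpha> D" "Y \<subseteq> verts G" "\<alpha> \<le> 1"
  shows "energy G \<alpha> (verts G) (verts G) \<le> energy G \<alpha> D Y"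
proof -
  define C where "C v = (if v \<in> D then Black else White)" for v
  have D: "black_set G C = D"
    using assms(1) by (auto simp: black_set_def C_def two_way_dynamo_def)
  obtain t where "\<forall>v\<in>verts G. config_at G \<alpha> C t v = Black"
    using assms(1) unfolding two_way_dynamo_def by (metis C_def)
  then have t: "black_set G (config_at G \<alpha> C t) = verts G"
    by (auto simp: black_set_def)
  \<comment> \<open>No threshold exceeds the degree, so the all-black configuration is fixed and the
    final energy is that of the pair \<open>verts G\<close>, \<open>verts G\<close>.\<close>
  have "black_set G (config_at G \<alpha> C (Suc t)) = verts G"
    using threshold_le_out_degree[OF assms(3), of G]
    by (simp add: config_at_Suc black_set_two_way_step t flip: out_degree_eq_adjacent_in)
  with energy_config_at_le[OF assms(2), of \<alpha> C t] show ?thesis by (simp add: t D)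
qed

section \<open>Positive degrees and nonempty dynamos\<close>

lemma out_degree_pos:
  assumes "Digraph_Component.connected G" "card (verts G) \<ge> 2" "v \<in> verts G"
  shows "out_degree G v > 0"
proof -
  obtain u where u: "u \<in> verts G" "u \<noteq> v"
    using assms(2,3) by (metis card_le_Suc0_iff_eq finite_verts not_less_eq_eq numeral_2_eq_2)
  have "v \<rightarrow>\<^sup>*\<^bsub>G\<^esub> u"
    using assms u by (auto simp: connected_def strongly_connected_def reachable_mk_symmetric_eq[OF sym_arcs])
  then obtain w where "v \<rightarrow>\<^bsub>G\<^esub> w"
    using u by (cases rule: converse_reachable_cases) auto
  then have "w \<in> {u \<in> verts G. v \<rightarrow>\<^bsub>G\<^esub> u}" by auto
  then show ?thesis
    unfolding out_degree_eq_adjacent_in adjacent_in_def by (subst card_gt_0_iff) auto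
qed

text \<open>Positive degrees make all thresholds positive, so the all-white configuration never
  changes.\<close>

lemma two_way_dynamo_nonempty:
  assumes "two_way_dynamo G \<alpha> D" "0 < \<alpha>" "\<And>v. v \<in> verts G \<Longrightarrow> out_degree G v > 0"
    "verts G \<noteq> {}"
  shows "D \<noteq> {}"
proof
  assume "D = {}"
  have "black_set G (config_at G \<alpha> (\<lambda>_. White) t) = {}" for t
  proof (induction t)
    case 0
    show ?case by (simp add: config_at_def black_set_def)
  next
    case (Suc t)
    then show ?case
      using assms(2,3)
      by (auto simp: config_at_Suc black_set_two_way_step adjacent_in_def threshold_def not_le)
  qed
  moreover obtain t where "\<forall>v\<in>verts G. config_at G \<alpha> (\<lambda>_. White) t v = Black"
    using assms(1) \<open>D = {}\<close> by (auto simp: two_way_dynamo_def)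
  ultimately show False using assms(4) by (fastforce simp: black_set_def)
qed

section \<open>Bounding the order of the graph by the size of a dynamo\<close>

lemma two_way_dynamo_order_bound:
  assumes "two_way_dynamo G \<alpha> D" "3 / 4 < \<alpha>" "\<alpha> < 1"
    "\<And>v. v \<in> verts G \<Longrightarrow> out_degree G v > 0"
  shows "real (card (verts G)) \<le> card D + (1 - \<alpha>) / \<alpha> * (card D * (real (card D) - 1))"
proof -
  define d where "d v = real (out_degree G v)" for v
  define \<tau> where "\<tau> v = real_of_int (threshold G \<alpha> v)" for v
  define W where "W = verts G - D"
  define k where "k = real (card D)"
  define \<beta> where "\<beta> = (1 - \<alpha>) / \<alpha>"
  have D: "D \<subseteq> verts G" "finite D"
    using assms(1) finite_subset[OF _ finite_verts] by (auto simp: two_way_dynamo_def)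
  have W: "W \<subseteq> verts G" "finite W" "D \<inter> W = {}" "D \<union> W = verts G"
    using D by (auto simp: W_def)
  have \<beta>: "0 \<le> \<beta>" "\<beta> < 1 / 3" using assms(2,3) by (auto simp: \<beta>_def field_simps)
  have split: "sum f (verts G) = sum f D + sum f W" for f :: "'a \<Rightarrow> real"
    using sum.union_disjoint[OF D(2) W(2,3)] W(4) by metis
  have real_energy: "real_of_int (energy G \<alpha> X Y) =
      sum \<tau> X + sum \<tau> Y - (\<Sum>v\<in>Y. real (adjacent_in G X v))" for X Y
    by (simp add: energy_def \<tau>_def)
  have adj_verts: "real (adjacent_in G (verts G) v) = d v" for v
    by (simp add: d_def out_degree_eq_adjacent_in)
  have lower: "2 * sum \<tau> (verts G) - sum d (verts G) \<le>
      sum \<tau> D + sum \<tau> Y - (\<Sum>v\<in>Y. real (adjacent_in G D v))" if "Y \<subseteq> verts G" for Y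
  proof -
    have "real_of_int (energy G \<alpha> (verts G) (verts G)) \<le> real_of_int (energy G \<alpha> D Y)"
      using energy_dynamo_ge[OF assms(1) that] assms(3) by simp
    then show ?thesis unfolding real_energy adj_verts by simp
  qed
  have 1: "sum \<tau> D + 2 * sum \<tau> W \<le> sum d D + sum d W"
    using lower[of "{}"] by (simp add: split)
  \<comment> \<open>The degree sum of \<open>D\<close> splits into pairs inside \<open>D\<close> and
    pairs from \<open>D\<close> to \<open>W\<close>; the latter cancel against the interaction term
    of the energy at \<open>Y = W\<close>.\<close>
  have 2: "sum \<tau> D \<le> k * (k - 1) + (sum d W - sum \<tau> W)"
  proof -
    have "(\<Sum>v\<in>W. real (adjacent_in G D v)) = (\<Sum>v\<in>D. real (adjacent_in G W v))"
      using sum_adjacent_in_commute[OF D(2) W(2)] by (simp flip: of_nat_sum)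
    moreover have "d v = real (adjacent_in G D v) + real (adjacent_in G W v)" for v
      using adjacent_in_Un[OF D(2) W(2,3), of v] by (simp add: W(4) flip: adj_verts)
    then have "sum d D = (\<Sum>v\<in>D. real (adjacent_in G D v)) + (\<Sum>v\<in>D. real (adjacent_in G W v))"
      by (simp add: sum.distrib)
    moreover have "(\<Sum>v\<in>D. real (adjacent_in G D v)) \<le> k * (k - 1)"
    proof -
      have "real (adjacent_in G D v) \<le> k - 1" if "v \<in> D" for v
      proof -
        \<comment> \<open>Ensures that the truncated \<open>card D - 1\<close> agrees with the real
          number \<open>k - 1\<close>.\<close>
        have "card D > 0" using that D(2) by (auto simp: card_gt_0_iff)
        then show ?thesis using adjacent_in_le_card[OF D(2) that] by (simp add: k_def)
      qed
      then show ?thesis unfolding k_def by (rule sum_bounded_above)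
    qed
    ultimately show ?thesis using lower[OF W(1)] by (simp add: split)
  qed
  have \<tau>_ge: "\<alpha> * d v \<le> \<tau> v" for v
    by (simp add: \<tau>_def threshold_def d_def)
  \<comment> \<open>From \<open>d v \<le> \<tau> v / \<alpha>\<close> and
    \<open>1 / \<alpha> - 1 = \<beta>\<close>.\<close>
  have "d v - \<tau> v \<le> \<beta> * \<tau> v" for v
    using \<tau>_ge[of v] assms(2) by (simp add: \<beta>_def field_simps)
  then have "(\<Sum>v\<in>D. d v - \<tau> v) \<le> (\<Sum>v\<in>D. \<beta> * \<tau> v)" by (rule sum_mono)
  then have 3: "sum d D - sum \<tau> D \<le> \<beta> * sum \<tau> D"
    by (simp add: sum_subtractf sum_distrib_left)
  have "1 \<le> 2 * \<tau> v - d v - \<beta> * (d v - \<tau> v)" if "v \<in> W" for v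
  proof -
    define z where "z = int (out_degree G v)"
    define y where "y = threshold G \<alpha> v"
    have dz: "d v = of_int z" "\<tau> v = of_int y" by (simp_all add: d_def z_def y_def \<tau>_def)
    have "z > 0" using assms(4) that W(1) by (auto simp: z_def)
    then have "3 / 4 * d v < \<alpha> * d v" using assms(2) by (simp add: dz)
    with \<tau>_ge[of v] have "3 * real_of_int z < 4 * real_of_int y" by (simp add: dz)
    \<comment> \<open>A strict inequality between integers gains 1. With \<open>s = z - y\<close>
      this says \<open>y \<ge> 3 * s + 1\<close>, so the summand \<open>y - s - \<beta> * s\<close>
      is at least \<open>1 + (2 - \<beta>) * s\<close>, hence at least 1.\<close>
    then have y: "3 * z + 1 \<le> 4 * y" by linarith
    have "y \<le> z" unfolding y_def z_def
      using assms(3) by (intro threshold_le_out_degree) simp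
    then have "\<beta> * real_of_int (z - y) \<le> 1 / 3 * real_of_int (z - y)"
      using \<beta> by (intro mult_right_mono) auto
    moreover have "3 * real_of_int (z - y) + 1 \<le> real_of_int y" "real_of_int (z - y) \<ge> 0"
      using y \<open>y \<le> z\<close> by auto
    ultimately show ?thesis unfolding dz by simp
  qed
  then have "(\<Sum>v\<in>W. 1) \<le> (\<Sum>v\<in>W. 2 * \<tau> v - d v - \<beta> * (d v - \<tau> v))" by (rule sum_mono)
  then have "real (card W) \<le> 2 * sum \<tau> W - sum d W - \<beta> * (sum d W - sum \<tau> W)"
    by (simp add: sum_subtractf flip: sum_distrib_left)
  also have "\<dots> \<le> \<beta> * sum \<tau> D - \<beta> * (sum d W - sum \<tau> W)" using 1 3 by simp
  \<comment> \<open>Scaling \<open>2\<close> by \<open>\<beta>\<close> eliminates both threshold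
    sums and the degree sum.\<close>
  also have "\<dots> \<le> \<beta> * (k * (k - 1))"
    using mult_left_mono[OF 2 \<beta>(1)] by (simp add: algebra_simps)
  finally have "real (card W) \<le> \<beta> * (k * (k - 1))" .
  moreover have "card (verts G) = card D + card W"
    using card_Un_disjoint[OF D(2) W(2,3)] W(4) by simp
  ultimately show ?thesis by (simp add: \<beta>_def k_def)
qed

end

section \<open>From the quadratic bound to the square root\<close>

lemma sqrt_bound_of_order_bound:
  fixes \<alpha> k x :: real
  assumes "3 / 4 < \<alpha>" "\<alpha> < 1" "0 \<le> k" "x \<le> k + (1 - \<alpha>) / \<alpha> * (k * (k - 1))"
  shows "2 * \<alpha> * sqrt x - 1 \<le> k"
proof -
  have "4 * \<alpha>\<^sup>2 * x \<le> 4 * \<alpha>\<^sup>2 * (k + (1 - \<alpha>) / \<alpha> * (k * (k - 1)))"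
    using assms(4) by (intro mult_left_mono) auto
  also have "\<dots> = 4 * \<alpha>\<^sup>2 * k + 4 * \<alpha> * (1 - \<alpha>) * (k * (k - 1))"
    using assms(1) by (simp add: field_simps power2_eq_square)
  \<comment> \<open>The square is chosen to match the \<open>k\<^sup>2\<close> terms, as \<open>1 -
    (2 * \<alpha> - 1)\<^sup>2 = 4 * \<alpha> * (1 - \<alpha>)\<close>; what remains is linear in
    \<open>k\<close> and has the right sign.\<close>
  also have "\<dots> = (k + 1)\<^sup>2 - ((2 * \<alpha> - 1) * k - 1)\<^sup>2 - 8 * \<alpha> * (1 - \<alpha>) * k"
    by (simp add: algebra_simps power2_eq_square)
  also have "\<dots> \<le> (k + 1)\<^sup>2"
  proof -
    have "0 \<le> 8 * \<alpha> * (1 - \<alpha>) * k" using assms(1-3) by simp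
    then show ?thesis using zero_le_power2[of "(2 * \<alpha> - 1) * k - 1"] by linarith
  qed
  finally have "(2 * \<alpha>)\<^sup>2 * x \<le> (k + 1)\<^sup>2" by (simp add: power_mult_distrib)
  then have "sqrt ((2 * \<alpha>)\<^sup>2 * x) \<le> k + 1"
    using assms(3) by (intro real_le_lsqrt) auto
  then show ?thesis using assms(1) by (simp add: real_sqrt_mult)
qed

lemma min_two_way_dynamo_attained:
  assumes "graph G"
  obtains D where "two_way_dynamo G \<alpha> D" "card D = min_two_way_dynamo G \<alpha>"
proof -
  have "min_two_way_dynamo G \<alpha> \<in> {card D | D. two_way_dynamo G \<alpha> D}"
    unfolding min_two_way_dynamo_def
    using two_way_dynamo_verts by (intro Min_in finite_dynamo_sizes[OF assms]) blast
  with that show thesis by force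
qed

theorem theorem2:
  fixes G :: "('a, 'b) pre_digraph" and n :: nat and \<alpha> :: real
  assumes "graph G" and "Digraph_Component.connected G"
    and "n = card (verts G)" and "n \<ge> 2"
    and "0 < \<alpha>" and "\<alpha> < 1"
  shows "(\<alpha> > 3 / 4 \<longrightarrow>
            2 * \<alpha> * sqrt (real n) - 1 \<le> real (min_two_way_dynamo G \<alpha>) \<and>
            min_two_way_dynamo G \<alpha> \<le> n) \<and>
         (\<alpha> \<le> 3 / 4 \<longrightarrow>
            1 \<le> min_two_way_dynamo G \<alpha> \<and> min_two_way_dynamo G \<alpha> \<le> n)"
proof -
  interpret graph G by fact
  obtain D where D: "two_way_dynamo G \<alpha> D" "card D = min_two_way_dynamo G \<alpha>"
    using min_two_way_dynamo_attained[OF assms(1)] .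
  have deg: "out_degree G v > 0" if "v \<in> verts G" for v
    using out_degree_pos[OF assms(2) _ that] assms(3,4) by simp
  have sub: "D \<subseteq> verts G" using D(1) by (simp add: two_way_dynamo_def)
  then have "card D \<le> n" by (simp add: assms(3) card_mono)
  moreover have "1 \<le> card D"
  proof -
    have "D \<noteq> {}"
      using assms(3,4) by (intro two_way_dynamo_nonempty[OF D(1) assms(5) deg]) auto
    then show ?thesis using finite_subset[OF sub] by (simp add: Suc_le_eq card_gt_0_iff)
  qed
  moreover have "2 * \<alpha> * sqrt (real n) - 1 \<le> card D" if "\<alpha> > 3 / 4"
    using two_way_dynamo_order_bound[OF D(1) that assms(6) deg] that assms(6)
    by (intro sqrt_bound_of_order_bound) (simp_all add: assms(3))
  ultimately show ?thesis by (simp add: D(2))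
qed

end
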